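(* For all non-negative integers $n,p,q$ with $q\le p$ and all complex numbers $z,w,\gamma$, $$H_{n}^{(p)}(z|\gamma)=\sum_{k=0}^{n}\binom{n}{k}H_{n-k,k}^{(p-q,q)}(z-w,w|\gamma).$$
   Context: For non-negative integers $n,m,p,q$ and complex $z,w,\gamma$, $$H_{n,m}^{(p,q)}(z,w|\gamma)= n!\,m!\sum_{k=0}^{\lfloor n/p\rfloor\wedge\lfloor m/q\rfloor}\frac{\gamma^k}{k!}\frac{z^{n-pk}}{(n-pk)!}\frac{w^{m-qk}}{(m-qk)!},$$ where $a\wedge b=\min\{a,b\}$ and $\lfloor j/0\rfloor=+\infty$ by convention (so for $p=q=0$ the sum is the infinite series $e^{\gamma}z^nw^m$); $0^0=1$. The Gould--Hopper polynomials are $$H_{n}^{(p)}(z|\gamma)=n!\sum_{k=0}^{\lfloor n/p\rfloor}\frac{\gamma^k}{k!}\frac{z^{n-pk}}{(n-pk)!},$$ with the same convention (so $H_n^{(0)}(z|\gamma)=e^\gamma z^n$). *)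

theory Defs
  imports Complex_Main "HOL-Library.Extended_Nat" "HOL-Analysis.Infinite_Sum"
begin

text \<open>The integer part of \<open>j / p\<close>, with value \<open>\<infinity>\<close> for \<open>p = 0\<close>.\<close>

definition floor_quot :: "nat \<Rightarrow> nat \<Rightarrow> enat" where
  "floor_quot j p = (if p = 0 then \<infinity> else enat (j div p))"

text \<open>
  The index range is infinite exactly when the bound is \<open>\<infinity>\<close>, in which case the sum is an
  absolutely convergent series; otherwise it is an ordinary finite sum.  The truncated
  subtractions are exact on the index range.
\<close>

definition gen_hermite2 ::
    "nat \<Rightarrow> nat \<Rightarrow> nat \<Rightarrow> nat \<Rightarrow> complex \<Rightarrow> complex \<Rightarrow> complex \<Rightarrow> complex" where
  "gen_hermite2 p q n m z w \<gamma> =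
     fact n * fact m *
     (\<Sum>\<^sub>\<infinity>k | enat k \<le> min (floor_quot n p) (floor_quot m q).
        \<gamma> ^ k / fact k * (z ^ (n - p * k) / fact (n - p * k)) * (w ^ (m - q * k) / fact (m - q * k)))"

definition gould_hopper :: "nat \<Rightarrow> nat \<Rightarrow> complex \<Rightarrow> complex \<Rightarrow> complex" where
  "gould_hopper p n z \<gamma> =
     fact n *
     (\<Sum>\<^sub>\<infinity>k | enat k \<le> floor_quot n p.
        \<gamma> ^ k / fact k * (z ^ (n - p * k) / fact (n - p * k)))"

lemma infsum_exp: "(\<Sum>\<^sub>\<infinity>k. \<gamma> ^ k / fact k) = exp (\<gamma> :: complex)"
proof -
  have "summable (\<lambda>k. norm (\<gamma> ^ k / fact k))"
    using summable_norm_exp[of \<gamma>] by (simp add: scaleR_conv_of_real field_simps norm_mult norm_divide norm_power)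
  moreover have "(\<lambda>k. \<gamma> ^ k / fact k) sums exp \<gamma>"
    using exp_converges[of \<gamma>] by (simp add: scaleR_conv_of_real field_simps)
  ultimately show ?thesis
    by (intro infsumI norm_summable_imp_has_sum)
qed

lemma gen_hermite2_0_0: "gen_hermite2 0 0 n m z w \<gamma> = exp \<gamma> * z ^ n * w ^ m"
proof -
  have "(\<Sum>\<^sub>\<infinity>k. \<gamma> ^ k / fact k * (z ^ n / fact n) * (w ^ m / fact m))
      = (\<Sum>\<^sub>\<infinity>k. \<gamma> ^ k / fact k) * ((z ^ n / fact n) * (w ^ m / fact m))"
    by (simp only: mult.assoc infsum_cmult_left')
  then show ?thesis
    by (simp add: gen_hermite2_def floor_quot_def infsum_exp)
qed

lemma gould_hopper_0: "gould_hopper 0 n z \<gamma> = exp \<gamma> * z ^ n"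
proof -
  have "(\<Sum>\<^sub>\<infinity>k. \<gamma> ^ k / fact k * (z ^ n / fact n)) = (\<Sum>\<^sub>\<infinity>k. \<gamma> ^ k / fact k) * (z ^ n / fact n)"
    by (simp only: infsum_cmult_left')
  then show ?thesis
    by (simp add: gould_hopper_def floor_quot_def infsum_exp)
qed

lemma gould_hopper_pos:
  assumes "p > 0"
  shows "gould_hopper p n z \<gamma> =
     fact n * (\<Sum>k\<le>n div p. \<gamma> ^ k / fact k * (z ^ (n - p * k) / fact (n - p * k)))"
  using assms by (simp add: gould_hopper_def floor_quot_def flip: atMost_def)

end

(* Since (n choose k) (n-k)! k! = n!, the right-hand side is n! times a double sum over k and the
   summation index j of H. Summing over k first, for fixed j, gives the binomial expansion of
   z^(n-pj) / (n-pj)! with z = (z-w) + w, shifted by k = qj + i. For p = 0 the series in j is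
   infinite and merely contributes the factor exp \<gamma>. *)
theory Submission
  imports Defs
begin

text \<open>For \<open>p = 0\<close> both sides are true, so the convention for a zero divisor needs
  no separate case once index ranges are written without division.\<close>

lemma enat_le_floor_quot_iff: "enat k \<le> floor_quot n p \<longleftrightarrow> p * k \<le> n"
  by (simp add: floor_quot_def less_eq_div_iff_mult_less_eq mult.commute)

lemma gen_hermite2_altdef:
  "gen_hermite2 p q n m z w \<gamma> =
     fact n * fact m *
     (\<Sum>\<^sub>\<infinity>k | p * k \<le> n \<and> q * k \<le> m.
        \<gamma> ^ k / fact k * (z ^ (n - p * k) / fact (n - p * k)) * (w ^ (m - q * k) / fact (m - q * k)))"
  by (simp add: gen_hermite2_def enat_le_floor_quot_iff)

lemma gould_hopper_altdef:
  "gould_hopper p n z \<gamma> =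
     fact n * (\<Sum>\<^sub>\<infinity>k | p * k \<le> n. \<gamma> ^ k / fact k * (z ^ (n - p * k) / fact (n - p * k)))"
  by (simp add: gould_hopper_def enat_le_floor_quot_iff)

text \<open>Dividing the binomial theorem by \<open>fact N\<close> splits the binomial coefficient
  between the two powers and leaves a plain convolution.\<close>

lemma binomial_divided_powers:
  fixes x y :: "'a :: field_char_0"
  shows "(\<Sum>i\<le>N. (x ^ (N - i) / fact (N - i)) * (y ^ i / fact i)) = (x + y) ^ N / fact N"
proof -
  have "(x + y) ^ N / fact N = (\<Sum>i\<le>N. of_nat (N choose i) * y ^ i * x ^ (N - i) / fact N)"
    by (simp add: add.commute[of x] binomial_ring sum_divide_distrib)
  also have "\<dots> = (\<Sum>i\<le>N. (x ^ (N - i) / fact (N - i)) * (y ^ i / fact i))"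
    by (intro sum.cong) (auto simp: binomial_fact mult.commute)
  finally show ?thesis by simp
qed

text \<open>The range conditions amount to b \<le> k \<le> n - a, where neither exponent is
  truncated. Substituting k = b + i with i \<le> n - (a + b) gives the unshifted
  convolution.\<close>

lemma shifted_binomial_divided_powers:
  fixes x y :: "'a :: field_char_0"
  assumes "a + b \<le> n"
  shows "(\<Sum>k | k \<le> n \<and> a \<le> n - k \<and> b \<le> k.
            (x ^ (n - k - a) / fact (n - k - a)) * (y ^ (k - b) / fact (k - b))) =
         (x + y) ^ (n - (a + b)) / fact (n - (a + b))"
  unfolding binomial_divided_powers[symmetric]
  using assms
  by (intro sum.reindex_bij_witness[of _ "\<lambda>i. b + i" "\<lambda>k. k - b"]) (auto simp: add.commute)

text \<open>Here \<open>p - q\<close> and \<open>q\<close> are not both zero, so every series is a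
  finite sum and the exchange of summations raises no convergence question.\<close>

lemma gould_hopper_eq_sum_gen_hermite2_pos:
  assumes "q \<le> p" "p > 0"
  shows "gould_hopper p n z \<gamma> =
    (\<Sum>k\<le>n. of_nat (n choose k) * gen_hermite2 (p - q) q (n - k) k (z - w) w \<gamma>)"
proof -
  \<comment> \<open>The factor in \<gamma> stands apart so that it can leave the sum over k for
    fixed j.\<close>
  define g where "g k j = \<gamma> ^ j / fact j *
    (((z - w) ^ (n - k - (p - q) * j) / fact (n - k - (p - q) * j)) *
     (w ^ (k - q * j) / fact (k - q * j)))" for k j
  define R where "R k j \<longleftrightarrow> (p - q) * j \<le> n - k \<and> q * j \<le> k" for k j
  \<comment> \<open>The range of j on the left-hand side does not depend on k. It serves as a common
    finite range from which \<open>R k j\<close> selects.\<close>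
  define J where "J = {j. p * j \<le> n}"
  have split: "(p - q) * j + q * j = p * j" for j
    using assms(1) by (metis add_mult_distrib le_add_diff_inverse2)
  have fin: "finite J"
  proof (rule finite_subset)
    have "j \<le> n" if "p * j \<le> n" for j
      by (rule order_trans[OF _ that]) (use assms(2) in simp)
    thus "J \<subseteq> {..n}" by (auto simp: J_def)
  qed simp
  \<comment> \<open>Adding the two inequalities in \<open>R k j\<close> gives p j \<le> (n - k) + k,
    which equals n because k \<le> n.\<close>
  have index: "{j. R k j} = {j \<in> J. R k j}" if "k \<le> n" for k
  proof -
    have "p * j \<le> n" if "R k j" for j
      using that \<open>k \<le> n\<close> split[of j] unfolding R_def by linarith
    thus ?thesis by (auto simp: J_def)
  qed
  have H: "of_nat (n choose k) * gen_hermite2 (p - q) q (n - k) k (z - w) w \<gamma>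
             = fact n * (\<Sum>j\<in>{j \<in> J. R k j}. g k j)" if "k \<le> n" for k
  proof -
    have "gen_hermite2 (p - q) q (n - k) k (z - w) w \<gamma>
            = fact (n - k) * fact k * infsum (g k) {j. R k j}"
      by (simp add: gen_hermite2_altdef R_def g_def[abs_def] mult.assoc)
    also have "infsum (g k) {j. R k j} = (\<Sum>j\<in>{j \<in> J. R k j}. g k j)"
      unfolding index[OF that] using fin by simp
    finally show ?thesis using that by (simp add: binomial_fact)
  qed
  have "(\<Sum>k\<le>n. of_nat (n choose k) * gen_hermite2 (p - q) q (n - k) k (z - w) w \<gamma>)
          = fact n * (\<Sum>k\<le>n. \<Sum>j\<in>{j \<in> J. R k j}. g k j)"
    by (simp add: H sum_distrib_left)
  also have "(\<Sum>k\<le>n. \<Sum>j\<in>{j \<in> J. R k j}. g k j)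
               = (\<Sum>j\<in>J. \<Sum>k\<in>{k \<in> {..n}. R k j}. g k j)"
    using fin by (intro sum.swap_restrict) auto
  also have "\<dots> = (\<Sum>j\<in>J. \<gamma> ^ j / fact j * (z ^ (n - p * j) / fact (n - p * j)))"
  proof (rule sum.cong)
    fix j assume "j \<in> J"
    hence "(p - q) * j + q * j \<le> n"
      by (simp add: split J_def)
    \<comment> \<open>The shifts are a = (p - q) j and b = q j. Their sum p j is free of q, and
      membership in \<open>J\<close> is exactly a + b \<le> n.\<close>
    from shifted_binomial_divided_powers[OF this, of "z - w" w]
    show "(\<Sum>k\<in>{k \<in> {..n}. R k j}. g k j) = \<gamma> ^ j / fact j * (z ^ (n - p * j) / fact (n - p * j))"
      unfolding g_def R_def split sum_distrib_left[symmetric] by simp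
  qed simp
  also have "fact n * \<dots> = gould_hopper p n z \<gamma>"
    using fin by (simp add: gould_hopper_altdef J_def)
  finally show ?thesis by simp
qed

theorem proposition8p1:
  fixes n p q :: nat and z w \<gamma> :: complex
  assumes "q \<le> p"
  shows "gould_hopper p n z \<gamma> =
    (\<Sum>k = 0..n. of_nat (n choose k) * gen_hermite2 (p - q) q (n - k) k (z - w) w \<gamma>)"
proof (cases "p = 0")
  case True
  \<comment> \<open>Since q \<le> p, also q = 0. Both sides carry the factor exp \<gamma>, and what
    remains is the expansion of (w + (z - w))^n.\<close>
  have "z ^ n = (\<Sum>k\<le>n. of_nat (n choose k) * w ^ k * (z - w) ^ (n - k))"
    using binomial_ring[of w "z - w" n] by simp
  then show ?thesis
    using True assms
    by (simp add: gould_hopper_0 gen_hermite2_0_0 sum_distrib_left atLeast0AtMost mult_ac)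
next
  case False
  then show ?thesis
    using gould_hopper_eq_sum_gen_hermite2_pos[OF assms] by (simp add: atLeast0AtMost)
qed

end
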